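(* Let $$H_{\rm enr}(q,p;\theta,\vartheta)=H_{\rm scaf}(q,p;\theta)+\vartheta H_{\rm new}(q),$$ where $H_{\rm new}\in C^1$ and $\vartheta\in\mathbb R$ is a learnable scalar. Then: (1) the enriched momentum equation contains the new force channel $F_{\rm new}(q)=-\vartheta\nabla_qH_{\rm new}(q)$; (2) differentiating a rollout-dependent loss $J$ through the discrete update creates the direct sensitivity stream $$\frac{\partial J}{\partial\vartheta}=-\tau\sum_t\left\langle\frac{\partial J}{\partial p_{t+1}},\nabla_qH_{\rm new}(q_t)\right\rangle+\text{recursive terms};$$ (3) local identifiability of $\vartheta$ from force observations requires non-degenerate excitation of the new channel, i.e. the empirical Gram matrix over $\{\nabla_qH_{\rm new}(q_t)\}_t$ must be nonsingular on the observed force subspace.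
   Context: Here $q,p\in\mathbb R^d$ are configuration and momentum, $H_{\rm scaf}(q,p;\theta)=\tfrac12p^\top M^{-1}p+H_{\rm geom}(q)$ with $M\succ0$ is a base Hamiltonian with parameters $\theta$. The momentum equation is $\dot p=-\nabla_qH_{\rm enr}+(\text{dissipation and input terms not depending on }\vartheta\text{ directly})$. The discrete rollout with step $\tau>0$ is $$p_{t+1}=p_t-\tau\nabla_qH_{\rm scaf}(q_t,p_t)-\tau\vartheta\nabla_qH_{\rm new}(q_t)-\tau D_tM^{-1}p_t+\tau B_tu_t,\qquad q_{t+1}=q_t+\tau M^{-1}p_{t+1},$$ with $D_t\succeq0$ a dissipation matrix, $B_t$ an input matrix, $u_t$ an input. The loss $J$ is a differentiable function of the rollout $(q_t,p_t)_t$, and $\partial J/\partial p_{t+1}$, $\partial J/\partial q_{t+1}$ are its partial derivatives with respect to those trajectory entries. "Recursive terms" are the remaining chain-rule contributions, in which the dependence on $\vartheta$ enters through the derivatives $\partial q_t/\partial\vartheta$ and $\partial p_t/\partial\vartheta$ of the trajectory (including the contributions of $\partial q_{t+1}/\partial\vartheta$). "Local identifiability from force observations" means that two coefficients $\vartheta,\vartheta'$ inducing the same observed force along the rollout must coincide; the observed force subspace is the subspace of force directions in which the force is observed.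
   Formalization: In (2) the derivatives of q_t, p_t in ϑ are assumed to exist (C^1 does not ensure it). In (3) the Gram matrix is the scalar one of the gradients projected to the observed subspace; the d×d one is nonsingular there if ϑ is identifiable from each single observed direction. *)

theory Defs
  imports "HOL-Analysis.Analysis"
begin

definition grad :: "('a::real_inner \<Rightarrow> real) \<Rightarrow> 'a \<Rightarrow> 'a" where
  "grad f x = (THE g. GDERIV f x :> g)"

definition C1 :: "('a::real_inner \<Rightarrow> real) \<Rightarrow> bool" where
  "C1 f \<longleftrightarrow> (\<forall>x. f differentiable (at x)) \<and> continuous_on UNIV (grad f)"

definition pos_def :: "real^'d^'d \<Rightarrow> bool" where
  "pos_def A \<longleftrightarrow> transpose A = A \<and> (\<forall>x. x \<noteq> 0 \<longrightarrow> x \<bullet> (A *v x) > 0)"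

definition pos_semidef :: "real^'d^'d \<Rightarrow> bool" where
  "pos_semidef A \<longleftrightarrow> transpose A = A \<and> (\<forall>x. x \<bullet> (A *v x) \<ge> 0)"

definition H_scaf ::
  "real^'d^'d \<Rightarrow> ('th \<Rightarrow> real^'d \<Rightarrow> real) \<Rightarrow> 'th \<Rightarrow> real^'d \<Rightarrow> real^'d \<Rightarrow> real" where
  "H_scaf M Hgeom \<theta> q p = 1/2 * (p \<bullet> (matrix_inv M *v p)) + Hgeom \<theta> q"

definition H_enr ::
  "real^'d^'d \<Rightarrow> ('th \<Rightarrow> real^'d \<Rightarrow> real) \<Rightarrow> (real^'d \<Rightarrow> real) \<Rightarrow>
   'th \<Rightarrow> real \<Rightarrow> real^'d \<Rightarrow> real^'d \<Rightarrow> real" where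
  "H_enr M Hgeom Hnew \<theta> vartheta q p = H_scaf M Hgeom \<theta> q p + vartheta * Hnew q"

definition grad_q :: "(real^'d \<Rightarrow> real^'d \<Rightarrow> real) \<Rightarrow> real^'d \<Rightarrow> real^'d \<Rightarrow> real^'d" where
  "grad_q H q p = grad (\<lambda>x. H x p) q"

definition F_new :: "(real^'d \<Rightarrow> real) \<Rightarrow> real \<Rightarrow> real^'d \<Rightarrow> real^'d" where
  "F_new Hnew vartheta q = - (vartheta *\<^sub>R grad Hnew q)"

text \<open>The continuous-time momentum equation on the time set \<open>I\<close>; \<open>R\<close> collects the dissipation
  and input terms, which see the coefficient at most through the state.\<close>

definition momentum_equation ::
  "(real^'d \<Rightarrow> real^'d \<Rightarrow> real) \<Rightarrow> (real \<Rightarrow> real^'d \<Rightarrow> real^'d \<Rightarrow> real^'d) \<Rightarrow>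
   real set \<Rightarrow> (real \<Rightarrow> real^'d) \<Rightarrow> (real \<Rightarrow> real^'d) \<Rightarrow> bool" where
  "momentum_equation H R I x y \<longleftrightarrow>
     (\<forall>s\<in>I. (y has_vector_derivative (- grad_q H (x s) (y s) + R s (x s) (y s))) (at s within I))"

text \<open>The discrete update with coefficient \<open>vartheta\<close>, for the steps \<open>t = 0, \<dots>, T - 1\<close>.\<close>

definition discrete_rollout ::
  "real \<Rightarrow> real^'d^'d \<Rightarrow> (real^'d \<Rightarrow> real^'d \<Rightarrow> real) \<Rightarrow> (real^'d \<Rightarrow> real) \<Rightarrow>
   (nat \<Rightarrow> real^'d^'d) \<Rightarrow> (nat \<Rightarrow> real^'m^'d) \<Rightarrow> (nat \<Rightarrow> real^'m) \<Rightarrow> nat \<Rightarrow> real \<Rightarrow>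
   (nat \<Rightarrow> real^'d) \<Rightarrow> (nat \<Rightarrow> real^'d) \<Rightarrow> bool" where
  "discrete_rollout \<tau> M Hs Hnew D B u T vartheta q p \<longleftrightarrow>
     (\<forall>t<T. p (Suc t) = p t - \<tau> *\<^sub>R grad_q Hs (q t) (p t) - (\<tau> * vartheta) *\<^sub>R grad Hnew (q t)
                          - \<tau> *\<^sub>R (D t *v (matrix_inv M *v p t)) + \<tau> *\<^sub>R (B t *v u t) \<and>
            q (Suc t) = q t + \<tau> *\<^sub>R (matrix_inv M *v p (Suc t)))"

text \<open>A rollout over the times \<open>0, \<dots>, T\<close> as a point of a Euclidean space: \<open>idx\<close> is a bijection
  from the finite index type onto \<open>{..T}\<close>, so that the Frechet differentiability of the library
  applies to loss functions of the rollout.\<close>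

definition rollout_data ::
  "('n \<Rightarrow> nat) \<Rightarrow> (nat \<Rightarrow> real^'d) \<Rightarrow> (nat \<Rightarrow> real^'d) \<Rightarrow> ((real^'d)^'n) \<times> ((real^'d)^'n)" where
  "rollout_data idx q p = ((\<chi> i. q (idx i)), (\<chi> i. p (idx i)))"

definition dJ_dq ::
  "('n \<Rightarrow> nat) \<Rightarrow> (((real^'d)^'n) \<times> ((real^'d)^'n) \<Rightarrow> real) \<Rightarrow>
   (nat \<Rightarrow> real^'d) \<Rightarrow> (nat \<Rightarrow> real^'d) \<Rightarrow> nat \<Rightarrow> real^'d" where
  "dJ_dq idx J q p t = grad (\<lambda>x. J (rollout_data idx (q(t := x)) p)) (q t)"

definition dJ_dp ::
  "('n \<Rightarrow> nat) \<Rightarrow> (((real^'d)^'n) \<times> ((real^'d)^'n) \<Rightarrow> real) \<Rightarrow>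
   (nat \<Rightarrow> real^'d) \<Rightarrow> (nat \<Rightarrow> real^'d) \<Rightarrow> nat \<Rightarrow> real^'d" where
  "dJ_dp idx J q p t = grad (\<lambda>x. J (rollout_data idx q (p(t := x)))) (p t)"

text \<open>A family of trajectories has the coefficient as its first argument and the time as its
  second one; \<open>sens x vartheta t\<close> is the derivative of its entry at time \<open>t\<close> in the coefficient.\<close>

definition sens :: "(real \<Rightarrow> nat \<Rightarrow> real^'d) \<Rightarrow> real \<Rightarrow> nat \<Rightarrow> real^'d" where
  "sens x vartheta t = vector_derivative (\<lambda>\<eta>. x \<eta> t) (at vartheta)"

text \<open>The derivative of \<open>\<nabla>\<^sub>q H\<close> along the trajectory family. The coefficient inside \<open>H\<close>
  is held fixed, so only the trajectory is differentiated.\<close>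

definition sens_grad ::
  "(real^'d \<Rightarrow> real^'d \<Rightarrow> real) \<Rightarrow> (real \<Rightarrow> nat \<Rightarrow> real^'d) \<Rightarrow> (real \<Rightarrow> nat \<Rightarrow> real^'d) \<Rightarrow>
   real \<Rightarrow> nat \<Rightarrow> real^'d" where
  "sens_grad H q p vartheta t = vector_derivative (\<lambda>\<eta>. grad_q H (q \<eta> t) (p \<eta> t)) (at vartheta)"

text \<open>The chain-rule contributions other than the direct one. The bracket is the derivative of the
  momentum update when its explicit coefficient is held fixed, which is why \<open>H\<close> below is to be
  the enriched Hamiltonian at the fixed coefficient \<open>vartheta\<close>.\<close>

definition recursive_terms ::
  "real \<Rightarrow> real^'d^'d \<Rightarrow> (real^'d \<Rightarrow> real^'d \<Rightarrow> real) \<Rightarrow> (nat \<Rightarrow> real^'d^'d) \<Rightarrow>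
   ('n \<Rightarrow> nat) \<Rightarrow> (((real^'d)^'n) \<times> ((real^'d)^'n) \<Rightarrow> real) \<Rightarrow> nat \<Rightarrow>
   (real \<Rightarrow> nat \<Rightarrow> real^'d) \<Rightarrow> (real \<Rightarrow> nat \<Rightarrow> real^'d) \<Rightarrow> real \<Rightarrow> real" where
  "recursive_terms \<tau> M H D idx J T q p vartheta =
     (\<Sum>t<T. dJ_dp idx J (q vartheta) (p vartheta) (Suc t) \<bullet>
               (sens p vartheta t - \<tau> *\<^sub>R sens_grad H q p vartheta t
                  - \<tau> *\<^sub>R (D t *v (matrix_inv M *v sens p vartheta t)))
           + dJ_dq idx J (q vartheta) (p vartheta) (Suc t) \<bullet> sens q vartheta (Suc t))"

text \<open>For a subspace \<open>S\<close> of observed force directions, \<open>closest_point S\<close> is the orthogonal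
  projection onto \<open>S\<close>, so \<open>closest_point S f\<close> is the observed part of a force \<open>f\<close>.
  \<open>F \<eta> t\<close> is the force that coefficient \<open>\<eta>\<close> induces at step \<open>t\<close> of a given rollout.\<close>

definition force_identifiable ::
  "(real^'d) set \<Rightarrow> nat \<Rightarrow> (real \<Rightarrow> nat \<Rightarrow> real^'d) \<Rightarrow> bool" where
  "force_identifiable S T F \<longleftrightarrow>
     (\<forall>\<eta> \<eta>'. (\<forall>t<T. closest_point S (F \<eta> t) = closest_point S (F \<eta>' t)) \<longrightarrow> \<eta> = \<eta>')"

text \<open>The Gram (normal-equation) matrix of the least-squares problem for the coefficients of the
  channels \<open>g k\<close>, \<open>k :: 'k\<close>, when only force components in \<open>S\<close> are observed.
  A single scalar coefficient corresponds to the index type \<open>1\<close>.\<close>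

definition observed_gram ::
  "(real^'d) set \<Rightarrow> nat \<Rightarrow> ('k \<Rightarrow> nat \<Rightarrow> real^'d) \<Rightarrow> real^'k^'k" where
  "observed_gram S T g =
     (\<chi> j k. \<Sum>t<T. closest_point S (g j t) \<bullet> closest_point S (g k t))"

text \<open>The Gram matrix in force space, \<open>\<Sum>\<^sub>t g\<^sub>t g\<^sub>t\<^sup>T\<close>, and nonsingularity of the
  compression of a matrix to a subspace.\<close>

definition force_gram :: "nat \<Rightarrow> (nat \<Rightarrow> real^'d) \<Rightarrow> real^'d^'d" where
  "force_gram T g = (\<chi> i j. \<Sum>t<T. g t $ i * g t $ j)"

definition nonsingular_on :: "(real^'d) set \<Rightarrow> real^'d^'d \<Rightarrow> bool" where
  "nonsingular_on S A \<longleftrightarrow> (\<forall>v\<in>S. closest_point S (A *v v) = 0 \<longrightarrow> v = 0)"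

end

theory Submission
  imports Defs
begin

text \<open>The update is affine in the coefficient, so writing
  \<open>\<eta> g(\<eta>) = (\<eta> - \<vartheta>) g(\<eta>) + \<vartheta> g(\<eta>)\<close> for \<open>g(\<eta>) = \<nabla>H\<^sub>n\<^sub>e\<^sub>w(q\<^sub>t(\<eta>))\<close> isolates the direct
  stream: the first summand has derivative \<open>g(\<vartheta>)\<close> at \<open>\<vartheta>\<close> by continuity of \<open>g\<close> alone. The update
  itself then shows that the enriched gradient along the trajectory is differentiable as soon as
  the trajectory is, although \<open>\<nabla>H\<^sub>n\<^sub>e\<^sub>w\<close> and \<open>\<nabla>H\<^sub>g\<^sub>e\<^sub>o\<^sub>m\<close> need not be. The observed force is affine
  in the coefficient with slope the projected channel, so identifiability fails if all projected
  excitations vanish.\<close>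

section \<open>Gradients of real functions and of the two Hamiltonians\<close>

lemma GDERIV_unique:
  fixes f :: "'a::real_inner \<Rightarrow> real"
  assumes "GDERIV f x :> a" "GDERIV f x :> b"
  shows "a = b"
proof -
  have "(\<lambda>h. h \<bullet> a) = (\<lambda>h. h \<bullet> b)"
    using assms unfolding gderiv_def by (rule has_derivative_unique)
  then have "(a - b) \<bullet> a = (a - b) \<bullet> b" by metis
  then have "(a - b) \<bullet> (a - b) = 0" by (simp add: inner_diff_right)
  then show ?thesis by simp
qed

lemma grad_eqI: "GDERIV f x :> a \<Longrightarrow> grad f x = a"
  unfolding grad_def by (blast intro: the_equality GDERIV_unique)

text \<open>Riesz representation in coordinates: a linear functional is the inner product with the
  vector of its values on the standard basis.\<close>

lemma has_derivative_GDERIV: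
  fixes f :: "'a::euclidean_space \<Rightarrow> real"
  assumes "(f has_derivative f') (at x)"
  shows "GDERIV f x :> (\<Sum>b\<in>Basis. f' b *\<^sub>R b)"
proof -
  interpret linear f' using assms by (rule has_derivative_linear)
  have "f' h = h \<bullet> (\<Sum>b\<in>Basis. f' b *\<^sub>R b)" for h
  proof -
    have "f' h = f' (\<Sum>b\<in>Basis. (h \<bullet> b) *\<^sub>R b)" by (simp add: euclidean_representation)
    also have "\<dots> = (\<Sum>b\<in>Basis. (h \<bullet> b) * f' b)" by (simp add: sum scale)
    finally show ?thesis by (simp add: inner_sum_right mult.commute)
  qed
  then have "f' = (\<lambda>h. h \<bullet> (\<Sum>b\<in>Basis. f' b *\<^sub>R b))" by blast
  with assms show ?thesis unfolding gderiv_def by simp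
qed

lemma GDERIV_grad:
  fixes f :: "'a::euclidean_space \<Rightarrow> real"
  assumes "f differentiable (at x)"
  shows "GDERIV f x :> grad f x"
  using assms has_derivative_GDERIV grad_eqI unfolding differentiable_def by metis

text \<open>Allows gradients to be evaluated direction by direction from a known Frechet derivative;
  this is how the partial gradients of the loss are computed.\<close>

lemma grad_inner:
  fixes f :: "'a::euclidean_space \<Rightarrow> real"
  assumes "(f has_derivative f') (at x)"
  shows "grad f x \<bullet> h = f' h"
proof -
  have "GDERIV f x :> grad f x"
    using assms by (intro GDERIV_grad) (auto simp: differentiable_def)
  then have "f' = (\<lambda>h. h \<bullet> grad f x)"
    unfolding gderiv_def using assms has_derivative_unique by blast
  then show ?thesis by (simp add: inner_commute)
qed

lemma grad_q_H_scaf: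
  assumes "Hgeom \<theta> differentiable (at x)"
  shows "grad_q (H_scaf M Hgeom \<theta>) x y = grad (Hgeom \<theta>) x"
proof -
  have "GDERIV (\<lambda>z. H_scaf M Hgeom \<theta> z y) x :> 0 + grad (Hgeom \<theta>) x"
    unfolding H_scaf_def by (intro GDERIV_add GDERIV_const GDERIV_grad assms)
  then show ?thesis unfolding grad_q_def by (simp add: grad_eqI)
qed

lemma grad_q_H_enr:
  assumes "Hgeom \<theta> differentiable (at x)" "Hnew differentiable (at x)"
  shows "grad_q (H_enr M Hgeom Hnew \<theta> v) x y = grad (Hgeom \<theta>) x + v *\<^sub>R grad Hnew x"
proof -
  \<comment> \<open>The first 0 is the kinetic energy, constant in the configuration; the second
    comes from the product rule with the constant factor \<open>v\<close>.\<close>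
  have "GDERIV (\<lambda>z. H_enr M Hgeom Hnew \<theta> v z y) x
      :> (0 + grad (Hgeom \<theta>) x) + (v *\<^sub>R grad Hnew x + Hnew x *\<^sub>R 0)"
    unfolding H_enr_def H_scaf_def
    by (intro GDERIV_add GDERIV_const GDERIV_grad GDERIV_mult assms)
  then show ?thesis unfolding grad_q_def by (simp add: grad_eqI)
qed

section \<open>Orthogonal projection onto a subspace\<close>

lemma closest_point_orthogonal:
  fixes S :: "'a::euclidean_space set"
  assumes "subspace S" "z \<in> S"
  shows "(x - closest_point S x) \<bullet> z = 0"
proof -
  let ?c = "closest_point S x"
  have S: "convex S" "closed S" "S \<noteq> {}"
    using assms subspace_imp_convex closed_subspace by auto
  have c: "?c \<in> S" using S closest_point_in_set by blast
  have "?c + z \<in> S" "?c - z \<in> S"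
    using c assms by (auto intro: subspace_add subspace_diff)
  then have "(x - ?c) \<bullet> (?c + z - ?c) \<le> 0" "(x - ?c) \<bullet> (?c - z - ?c) \<le> 0"
    using closest_point_dot[OF S(1,2)] by blast+
  then show ?thesis by simp
qed

lemma closest_point_subspace_eqI:
  fixes S :: "'a::euclidean_space set"
  assumes S: "subspace S" "y \<in> S" and orth: "\<And>z. z \<in> S \<Longrightarrow> (x - y) \<bullet> z = 0"
  shows "closest_point S x = y"
proof -
  let ?c = "closest_point S x"
  have c: "?c \<in> S"
    using S closed_subspace closest_point_in_set by blast
  then have d: "?c - y \<in> S" using S by (simp add: subspace_diff)
  \<comment> \<open>The difference of the two candidates lies in S and is orthogonal to S, hence to
    itself.\<close>
  have "(?c - y) \<bullet> (?c - y) = (x - y) \<bullet> (?c - y) - (x - ?c) \<bullet> (?c - y)"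
    by (simp add: inner_diff_left)
  also have "\<dots> = 0" using orth[OF d] closest_point_orthogonal[OF S(1) d] by simp
  finally show ?thesis by simp
qed

text \<open>Sums and multiples of projections again lie in S and leave a residual orthogonal to S,
  which characterizes the projection.\<close>

lemma linear_closest_point:
  fixes S :: "'a::euclidean_space set"
  assumes S: "subspace S"
  shows "linear (closest_point S)"
proof -
  have in_S: "closest_point S x \<in> S" for x
    using S closed_subspace closest_point_in_set subspace_0 by blast
  show ?thesis
  proof (rule linearI)
    show "closest_point S (x + y) = closest_point S x + closest_point S y" for x y
    proof (rule closest_point_subspace_eqI[OF S])
      show "(x + y - (closest_point S x + closest_point S y)) \<bullet> z = 0" if "z \<in> S" for z
        using closest_point_orthogonal[OF S that, of x] closest_point_orthogonal[OF S that, of y]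
        by (simp add: algebra_simps)
    qed (simp add: S in_S subspace_add)
    show "closest_point S (c *\<^sub>R x) = c *\<^sub>R closest_point S x" for c x
    proof (rule closest_point_subspace_eqI[OF S])
      show "(c *\<^sub>R x - c *\<^sub>R closest_point S x) \<bullet> z = 0" if "z \<in> S" for z
        using closest_point_orthogonal[OF S that, of x]
        by (simp flip: scaleR_diff_right)
    qed (simp add: S in_S subspace_scale)
  qed
qed

section \<open>Identifiability, excitation and Gram matrices\<close>

lemma force_identifiable_excited:
  assumes S: "subspace S" and F: "\<And>\<eta> t. F \<eta> t = c t - \<eta> *\<^sub>R g t"
    and ident: "force_identifiable S T F"
  obtains t where "t < T" "closest_point S (g t) \<noteq> 0"
proof -
  interpret linear "closest_point S" using S by (rule linear_closest_point)
  have "\<exists>t<T. closest_point S (g t) \<noteq> 0"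
  proof (rule ccontr)
    assume "\<not> ?thesis"
    \<comment> \<open>With no observed excitation the observed force is that of \<open>c t\<close>
      for every coefficient; 0 and 1 serve as two distinct ones.\<close>
    then have "\<forall>t<T. closest_point S (F 0 t) = closest_point S (F 1 t)"
      by (simp add: F diff)
    then have "(0::real) = 1" using ident unfolding force_identifiable_def by blast
    then show False by simp
  qed
  then show thesis using that by blast
qed

text \<open>The determinant of a 1 by 1 matrix is its entry, here a sum of squared norms with at
  least one positive summand.\<close>

lemma invertible_observed_gram_single:
  assumes "t < T" "closest_point S (g t) \<noteq> 0"
  shows "invertible (observed_gram S T (\<lambda>_::1. g))"
proof -
  have "(\<Sum>t<T. closest_point S (g t) \<bullet> closest_point S (g t)) > 0"
    using assms by (intro sum_pos2[where i = t]) auto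
  then show ?thesis by (simp add: invertible_det_nz det_1 observed_gram_def)
qed

text \<open>Each summand of the Gram matrix is the rank-one matrix of some \<open>g t\<close>, whose
  quadratic form is a square. A vector on which the whole form vanishes is therefore orthogonal to
  every excitation.\<close>

lemma inner_force_gram:
  "v \<bullet> (force_gram T g *v v) = (\<Sum>t<T. (v \<bullet> g t)\<^sup>2)"
proof -
  have "v \<bullet> (force_gram T g *v v)
      = (\<Sum>i\<in>UNIV. \<Sum>j\<in>UNIV. \<Sum>t<T. (v $ i * g t $ i) * (v $ j * g t $ j))"
    by (simp add: inner_vec_def force_gram_def matrix_vector_mult_def sum_distrib_left
        sum_distrib_right mult_ac)
  also have "\<dots> = (\<Sum>i\<in>UNIV. \<Sum>t<T. \<Sum>j\<in>UNIV. (v $ i * g t $ i) * (v $ j * g t $ j))"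
    by (intro sum.cong refl sum.swap)
  also have "\<dots> = (\<Sum>t<T. \<Sum>i\<in>UNIV. \<Sum>j\<in>UNIV. (v $ i * g t $ i) * (v $ j * g t $ j))"
    by (rule sum.swap)
  also have "\<dots> = (\<Sum>t<T. (v \<bullet> g t)\<^sup>2)"
    by (simp add: inner_vec_def power2_eq_square sum_product)
  finally show ?thesis .
qed

text \<open>A vector v of S in the kernel of the compression is orthogonal to all excitations, so an
  observer of the line through v sees nothing of the channel. This is why excitation is required on
  every line of S separately.\<close>

lemma nonsingular_on_force_gram:
  assumes S: "subspace S"
    and excited: "\<And>v. v \<in> S \<Longrightarrow> v \<noteq> 0 \<Longrightarrow> \<exists>t<T. closest_point (span {v}) (g t) \<noteq> 0"
  shows "nonsingular_on S (force_gram T g)"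
  unfolding nonsingular_on_def
proof (intro ballI impI)
  fix v assume v: "v \<in> S" and "closest_point S (force_gram T g *v v) = 0"
  then have "v \<bullet> (force_gram T g *v v) = 0"
    using closest_point_orthogonal[OF S v, of "force_gram T g *v v"] by (simp add: inner_commute)
  then have "(\<Sum>t<T. (v \<bullet> g t)\<^sup>2) = 0" by (simp add: inner_force_gram)
  then have zero: "v \<bullet> g t = 0" if "t < T" for t
    using that by (subst (asm) sum_nonneg_eq_0_iff) auto
  have "closest_point (span {v}) (g t) = 0" if "t < T" for t
  proof (rule closest_point_subspace_eqI)
    show "(g t - 0) \<bullet> z = 0" if "z \<in> span {v}" for z
      using that zero[OF \<open>t < T\<close>] by (auto simp: span_singleton inner_commute)
  qed (auto simp: span_0)
  then show "v = 0" using excited[OF v] by blast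
qed

section \<open>Derivatives of rollouts and the chain rule for the loss\<close>

lemma has_derivative_vec_lambda:
  fixes f :: "'a::real_normed_vector \<Rightarrow> 'n::finite \<Rightarrow> 'b::euclidean_space"
  assumes "\<And>i. ((\<lambda>x. f x i) has_derivative (\<lambda>h. f' h i)) (at a within A)"
  shows "((\<lambda>x. \<chi> i. f x i) has_derivative (\<lambda>h. \<chi> i. f' h i)) (at a within A)"
  by (subst has_derivative_componentwise_within)
    (auto simp: Basis_vec_def inner_axis intro!: has_derivative_inner_left assms)

lemma has_derivative_rollout_data:
  fixes idx :: "'n::finite \<Rightarrow> nat"
  assumes "\<And>i. ((\<lambda>x. Q x (idx i)) has_derivative (\<lambda>h. Q' h (idx i))) (at a)"
    and "\<And>i. ((\<lambda>x. P x (idx i)) has_derivative (\<lambda>h. P' h (idx i))) (at a)"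
  shows "((\<lambda>x. rollout_data idx (Q x) (P x)) has_derivative
           (\<lambda>h. rollout_data idx (Q' h) (P' h))) (at a)"
  unfolding rollout_data_def
  by (intro has_derivative_Pair has_derivative_vec_lambda assms)

text \<open>Splits a direction in rollout space into perturbations of single entries, so that a
  total derivative splits into partial ones. Since \<open>idx\<close> takes values up to T only,
  each component is met exactly once in the sum.\<close>

lemma rollout_data_decompose:
  fixes idx :: "'n::finite \<Rightarrow> nat" and v w :: "nat \<Rightarrow> real^'b"
  assumes "range idx \<subseteq> {..T}"
  shows "rollout_data idx v w =
    (\<Sum>t\<le>T. rollout_data idx ((\<lambda>_. 0)(t := v t)) (\<lambda>_. 0)
           + rollout_data idx (\<lambda>_. 0) ((\<lambda>_. 0)(t := w t)))"
proof -
  have "idx i \<le> T" for i using assms by auto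
  then have delta: "(\<Sum>t\<le>T. ((\<lambda>_. 0)(t := x t)) (idx i) $ j) = x (idx i) $ j"
    for x :: "nat \<Rightarrow> real^'b" and i j
    by (simp add: if_distrib[of "\<lambda>y. y $ j"] cong: if_cong)
  have "rollout_data idx ((\<lambda>_. 0)(t := v t)) (\<lambda>_. 0) + rollout_data idx (\<lambda>_. 0) ((\<lambda>_. 0)(t := w t))
      = rollout_data idx ((\<lambda>_. 0)(t := v t)) ((\<lambda>_. 0)(t := w t))" for t
    by (simp add: rollout_data_def vec_eq_iff)
  then show ?thesis
    by (simp add: rollout_data_def prod_eq_iff vec_eq_iff fst_sum snd_sum sum_component delta
        del: fun_upd_apply)
qed

lemma has_derivative_if_eq:
  "((\<lambda>x. if s = t then x else c) has_derivative (\<lambda>h. if s = t then h else 0)) F"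
  by (cases "s = t") auto

lemma dJ_dq_inner:
  fixes idx :: "'n::finite \<Rightarrow> nat"
  assumes "(J has_derivative J') (at (rollout_data idx q p))"
  shows "dJ_dq idx J q p t \<bullet> h = J' (rollout_data idx ((\<lambda>_. 0)(t := h)) (\<lambda>_. 0))"
  unfolding dJ_dq_def
proof (rule grad_inner)
  have "((\<lambda>x. rollout_data idx (q(t := x)) p) has_derivative
      (\<lambda>h. rollout_data idx ((\<lambda>_. 0)(t := h)) (\<lambda>_. 0))) (at (q t))"
    by (rule has_derivative_rollout_data) (simp_all add: has_derivative_if_eq)
  then show "((\<lambda>x. J (rollout_data idx (q(t := x)) p)) has_derivative
      (\<lambda>h. J' (rollout_data idx ((\<lambda>_. 0)(t := h)) (\<lambda>_. 0)))) (at (q t))"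
    \<comment> \<open>The base point is \<open>q t\<close>, where the update leaves \<open>q\<close>
      unchanged, so the derivative of \<open>J\<close> at the actual rollout applies.\<close>
    by (rule has_derivative_compose) (simp add: assms)
qed

lemma dJ_dp_inner:
  fixes idx :: "'n::finite \<Rightarrow> nat"
  assumes "(J has_derivative J') (at (rollout_data idx q p))"
  shows "dJ_dp idx J q p t \<bullet> h = J' (rollout_data idx (\<lambda>_. 0) ((\<lambda>_. 0)(t := h)))"
  unfolding dJ_dp_def
proof (rule grad_inner)
  have "((\<lambda>x. rollout_data idx q (p(t := x))) has_derivative
      (\<lambda>h. rollout_data idx (\<lambda>_. 0) ((\<lambda>_. 0)(t := h)))) (at (p t))"
    by (rule has_derivative_rollout_data) (simp_all add: has_derivative_if_eq)
  then show "((\<lambda>x. J (rollout_data idx q (p(t := x)))) has_derivative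
      (\<lambda>h. J' (rollout_data idx (\<lambda>_. 0) ((\<lambda>_. 0)(t := h))))) (at (p t))"
    by (rule has_derivative_compose) (simp add: assms)
qed

lemma loss_chain_rule:
  fixes idx :: "'n::finite \<Rightarrow> nat"
  assumes J: "J differentiable (at (rollout_data idx (q v) (p v)))"
    and idx: "range idx \<subseteq> {..T}"
    and q: "\<And>t. t \<le> T \<Longrightarrow> ((\<lambda>\<eta>. q \<eta> t) has_vector_derivative q' t) (at v)"
    and p: "\<And>t. t \<le> T \<Longrightarrow> ((\<lambda>\<eta>. p \<eta> t) has_vector_derivative p' t) (at v)"
  shows "((\<lambda>\<eta>. J (rollout_data idx (q \<eta>) (p \<eta>))) has_real_derivative
    (\<Sum>t\<le>T. dJ_dq idx J (q v) (p v) t \<bullet> q' t + dJ_dp idx J (q v) (p v) t \<bullet> p' t)) (at v)"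
proof -
  obtain J' where J': "(J has_derivative J') (at (rollout_data idx (q v) (p v)))"
    using J by (auto simp: differentiable_def)
  interpret linear J' using J' by (rule has_derivative_linear)
  have le: "idx i \<le> T" for i using idx by auto
  have "((\<lambda>\<eta>. rollout_data idx (q \<eta>) (p \<eta>)) has_derivative
      (\<lambda>h. rollout_data idx (\<lambda>t. h *\<^sub>R q' t) (\<lambda>t. h *\<^sub>R p' t))) (at v)"
    using q[OF le] p[OF le]
    by (intro has_derivative_rollout_data) (auto simp: has_vector_derivative_def)
  then have "((\<lambda>\<eta>. J (rollout_data idx (q \<eta>) (p \<eta>))) has_derivative
      (\<lambda>h. J' (rollout_data idx (\<lambda>t. h *\<^sub>R q' t) (\<lambda>t. h *\<^sub>R p' t)))) (at v)"
    by (rule has_derivative_compose) (rule J')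
  \<comment> \<open>Linearity of \<open>J'\<close> distributes it over the single-entry directions,
    and on each of them it is a partial gradient paired with the velocity of that entry.\<close>
  moreover have "J' (rollout_data idx (\<lambda>t. h *\<^sub>R q' t) (\<lambda>t. h *\<^sub>R p' t))
      = (\<Sum>t\<le>T. dJ_dq idx J (q v) (p v) t \<bullet> q' t + dJ_dp idx J (q v) (p v) t \<bullet> p' t) * h" for h
    by (subst rollout_data_decompose[OF idx])
      (simp add: sum add sum_distrib_left distrib_left mult.commute
        flip: dJ_dq_inner[OF J'] dJ_dp_inner[OF J'])
  ultimately show ?thesis
    by (simp add: has_field_derivative_def)
qed

section \<open>Vector derivatives in the coefficient\<close>

lemma has_vector_derivative_scaleR_continuous:
  fixes g :: "real \<Rightarrow> 'a::real_normed_vector"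
  assumes "isCont g v"
  shows "((\<lambda>\<eta>. (\<eta> - v) *\<^sub>R g \<eta>) has_vector_derivative g v) (at v)"
  unfolding has_vector_derivative_def has_derivative_at2
proof (intro conjI bounded_linear_scaleR_left)
  have "((\<lambda>\<eta>. norm (g \<eta> - g v)) \<longlongrightarrow> 0) (at v)"
    using assms unfolding isCont_def by (intro tendsto_norm_zero LIM_zero)
  \<comment> \<open>The scaled linearization error is a multiple of \<open>g \<eta> - g v\<close> by
    a factor of absolute value 1; at \<eta> = v both sides are 0, as \<open>1 / 0\<close> is
    0.\<close>
  moreover have "norm ((1 / norm (\<eta> - v)) *\<^sub>R
      ((\<eta> - v) *\<^sub>R g \<eta> - ((v - v) *\<^sub>R g v + (\<eta> - v) *\<^sub>R g v))) \<le> norm (g \<eta> - g v)" for \<eta>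
  proof -
    have eq: "(\<eta> - v) *\<^sub>R g \<eta> - ((v - v) *\<^sub>R g v + (\<eta> - v) *\<^sub>R g v) = (\<eta> - v) *\<^sub>R (g \<eta> - g v)"
      by (simp add: scaleR_diff_right)
    show ?thesis unfolding eq by simp
  qed
  ultimately show "((\<lambda>\<eta>. (1 / norm (\<eta> - v)) *\<^sub>R
      ((\<eta> - v) *\<^sub>R g \<eta> - ((v - v) *\<^sub>R g v + (\<eta> - v) *\<^sub>R g v))) \<longlongrightarrow> 0) (at v)"
    by (rule Lim_null_comparison[OF always_eventually, OF allI, rotated])
qed

lemma sens_works:
  assumes "(\<lambda>\<eta>. x \<eta> t) differentiable (at v)"
  shows "((\<lambda>\<eta>. x \<eta> t) has_vector_derivative sens x v t) (at v)"
  using assms unfolding sens_def by (simp add: vector_derivative_works)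

lemma has_vector_derivative_mult_vec:
  fixes A :: "real^'n^'m"
  assumes "(f has_vector_derivative f') F"
  shows "((\<lambda>x. A *v f x) has_vector_derivative A *v f') F"
  using assms by (rule bounded_linear.has_vector_derivative[OF matrix_vector_mul_bounded_linear])

lemma has_vector_derivative_compose_frechet:
  assumes "f differentiable (at (x v))" "(x has_vector_derivative x') (at v)"
  shows "((\<lambda>\<eta>. f (x \<eta>)) has_vector_derivative frechet_derivative f (at (x v)) x') (at v)"
proof -
  have f: "(f has_derivative frechet_derivative f (at (x v))) (at (x v))"
    using assms(1) by (simp add: frechet_derivative_works)
  interpret linear "frechet_derivative f (at (x v))" using f by (rule has_derivative_linear)
  show ?thesis
    using has_derivative_compose[OF assms(2)[unfolded has_vector_derivative_def] f]
    by (simp add: has_vector_derivative_def scale)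
qed

section \<open>Sensitivities of a family of rollouts at the coefficient v\<close>

context
  fixes M :: "real^'d^'d"
    and Hgeom :: "'th \<Rightarrow> real^'d \<Rightarrow> real"
    and Hnew :: "real^'d \<Rightarrow> real"
    and \<theta> :: 'th
    and \<tau> v :: real
    and D :: "nat \<Rightarrow> real^'d^'d"
    and B :: "nat \<Rightarrow> real^'m^'d"
    and u :: "nat \<Rightarrow> real^'m"
    and T :: nat
    and q p :: "real \<Rightarrow> nat \<Rightarrow> real^'d"
  assumes Hgeom: "\<And>x. Hgeom \<theta> differentiable (at x)"
    and Hnew: "C1 Hnew"
    and rollout: "\<And>\<eta>. discrete_rollout \<tau> M (H_scaf M Hgeom \<theta>) Hnew D B u T \<eta> (q \<eta>) (p \<eta>)"
begin

lemma Hnew_differentiable: "Hnew differentiable (at x)"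
  using Hnew by (simp add: C1_def)

lemmas scaf_gradient = grad_q_H_scaf[where Hgeom = Hgeom and \<theta> = \<theta>, OF Hgeom]

lemmas enr_gradient =
  grad_q_H_enr[where Hgeom = Hgeom and \<theta> = \<theta> and Hnew = Hnew, OF Hgeom Hnew_differentiable]

text \<open>Splitting the explicit coefficient as v + (\<eta> - v), the part with v joins the
  scaffold gradient to form the enriched gradient at fixed coefficient, and the rest is the direct
  stream.\<close>

lemma rollout_p:
  assumes "t < T"
  shows "p \<eta> (Suc t) = p \<eta> t - \<tau> *\<^sub>R grad_q (H_enr M Hgeom Hnew \<theta> v) (q \<eta> t) (p \<eta> t)
    - \<tau> *\<^sub>R ((\<eta> - v) *\<^sub>R grad Hnew (q \<eta> t))
    - \<tau> *\<^sub>R (D t *v (matrix_inv M *v p \<eta> t)) + \<tau> *\<^sub>R (B t *v u t)"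
  using rollout[of \<eta>] assms
  unfolding discrete_rollout_def scaf_gradient enr_gradient
  by (simp add: algebra_simps)

lemma rollout_q:
  assumes "t < T"
  shows "q \<eta> (Suc t) = q \<eta> t + \<tau> *\<^sub>R (matrix_inv M *v p \<eta> (Suc t))"
  using rollout[of \<eta>] assms unfolding discrete_rollout_def by blast

lemma direct_stream:
  assumes "(\<lambda>\<eta>. q \<eta> t) differentiable (at v)"
  shows "((\<lambda>\<eta>. (\<eta> - v) *\<^sub>R grad Hnew (q \<eta> t)) has_vector_derivative grad Hnew (q v t)) (at v)"
proof (rule has_vector_derivative_scaleR_continuous)
  have "isCont (\<lambda>\<eta>. q \<eta> t) v"
    using assms by (rule differentiable_imp_continuous_within)
  moreover have "isCont (grad Hnew) (q v t)"
    using Hnew by (simp add: C1_def continuous_on_eq_continuous_at)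
  ultimately show "isCont (\<lambda>\<eta>. grad Hnew (q \<eta> t)) v"
    by (rule isCont_o2)
qed

text \<open>The derivative \<open>G\<close> is left open because it is supplied in two ways: by
  solving the update for the gradient when the trajectory is known to be differentiable, and by the
  chain rule when the gradients are.\<close>

lemma momentum_sensitivity:
  assumes t: "t < T" and q: "(\<lambda>\<eta>. q \<eta> t) differentiable (at v)"
    and p: "(\<lambda>\<eta>. p \<eta> t) differentiable (at v)"
    and G: "((\<lambda>\<eta>. grad_q (H_enr M Hgeom Hnew \<theta> v) (q \<eta> t) (p \<eta> t))
              has_vector_derivative G) (at v)"
  shows "((\<lambda>\<eta>. p \<eta> (Suc t)) has_vector_derivative
    sens p v t - \<tau> *\<^sub>R G - \<tau> *\<^sub>R grad Hnew (q v t)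
      - \<tau> *\<^sub>R (D t *v (matrix_inv M *v sens p v t))) (at v)"
proof -
  have scale: "((\<lambda>\<eta>. \<tau> *\<^sub>R f \<eta>) has_vector_derivative \<tau> *\<^sub>R f') (at v)"
    if "(f has_vector_derivative f') (at v)" for f :: "real \<Rightarrow> real^'d" and f'
    using that by (rule bounded_linear.has_vector_derivative[OF bounded_linear_scaleR_right])
  have "((\<lambda>\<eta>. p \<eta> t - \<tau> *\<^sub>R grad_q (H_enr M Hgeom Hnew \<theta> v) (q \<eta> t) (p \<eta> t)
    - \<tau> *\<^sub>R ((\<eta> - v) *\<^sub>R grad Hnew (q \<eta> t))
    - \<tau> *\<^sub>R (D t *v (matrix_inv M *v p \<eta> t)) + \<tau> *\<^sub>R (B t *v u t)) has_vector_derivative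
    sens p v t - \<tau> *\<^sub>R G - \<tau> *\<^sub>R grad Hnew (q v t)
      - \<tau> *\<^sub>R (D t *v (matrix_inv M *v sens p v t)) + 0) (at v)"
    by (intro has_vector_derivative_add has_vector_derivative_diff has_vector_derivative_const
        scale has_vector_derivative_mult_vec sens_works p G direct_stream q)
  then show ?thesis by (simp add: rollout_p[OF t])
qed

text \<open>Solving the update for the enriched gradient, which needs a nonzero step, expresses it
  through terms already known to be differentiable in the coefficient. No second derivative of a
  Hamiltonian enters.\<close>

lemma sens_grad_works:
  assumes \<tau>: "\<tau> \<noteq> 0" and t: "t < T"
    and q: "(\<lambda>\<eta>. q \<eta> t) differentiable (at v)"
    and p: "(\<lambda>\<eta>. p \<eta> t) differentiable (at v)"
    and p': "(\<lambda>\<eta>. p \<eta> (Suc t)) differentiable (at v)"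
  shows "((\<lambda>\<eta>. grad_q (H_enr M Hgeom Hnew \<theta> v) (q \<eta> t) (p \<eta> t)) has_vector_derivative
    sens_grad (H_enr M Hgeom Hnew \<theta> v) q p v t) (at v)"
proof -
  have eq: "grad_q (H_enr M Hgeom Hnew \<theta> v) (q \<eta> t) (p \<eta> t) =
      (1 / \<tau>) *\<^sub>R (p \<eta> t - p \<eta> (Suc t)) - (\<eta> - v) *\<^sub>R grad Hnew (q \<eta> t)
      - D t *v (matrix_inv M *v p \<eta> t) + B t *v u t" for \<eta>
    using \<tau> by (simp add: rollout_p[OF t] algebra_simps)
  have "(\<lambda>\<eta>. (\<eta> - v) *\<^sub>R grad Hnew (q \<eta> t)) differentiable (at v)"
    using direct_stream[OF q] by (rule differentiableI_vector)
  moreover have "(\<lambda>\<eta>. (1 / \<tau>) *\<^sub>R (p \<eta> t - p \<eta> (Suc t))) differentiable (at v)"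
    using p p' by simp
  moreover have "(\<lambda>\<eta>. D t *v (matrix_inv M *v p \<eta> t)) differentiable (at v)"
    using has_vector_derivative_mult_vec[OF has_vector_derivative_mult_vec[OF sens_works[of p, OF p]]]
    by (rule differentiableI_vector)
  ultimately have "(\<lambda>\<eta>. grad_q (H_enr M Hgeom Hnew \<theta> v) (q \<eta> t) (p \<eta> t)) differentiable (at v)"
    unfolding eq by (intro differentiable_add differentiable_diff differentiable_const)
  then show ?thesis unfolding sens_grad_def by (simp add: vector_derivative_works)
qed

lemma sens_p_Suc:
  assumes "\<tau> \<noteq> 0" "t < T" "(\<lambda>\<eta>. q \<eta> t) differentiable (at v)"
    "(\<lambda>\<eta>. p \<eta> t) differentiable (at v)" "(\<lambda>\<eta>. p \<eta> (Suc t)) differentiable (at v)"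
  shows "sens p v (Suc t) = sens p v t - \<tau> *\<^sub>R sens_grad (H_enr M Hgeom Hnew \<theta> v) q p v t
    - \<tau> *\<^sub>R grad Hnew (q v t) - \<tau> *\<^sub>R (D t *v (matrix_inv M *v sens p v t))"
  using momentum_sensitivity[OF assms(2-4) sens_grad_works[OF assms]]
  by (simp add: sens_def vector_derivative_at)

lemma enriched_gradient_along_rollout:
  assumes grads: "grad (Hgeom \<theta>) differentiable (at (q v t))" "grad Hnew differentiable (at (q v t))"
    and q: "(\<lambda>\<eta>. q \<eta> t) differentiable (at v)"
  shows "((\<lambda>\<eta>. grad_q (H_enr M Hgeom Hnew \<theta> v) (q \<eta> t) (p \<eta> t)) has_vector_derivative
    frechet_derivative (\<lambda>x. grad_q (H_enr M Hgeom Hnew \<theta> v) x (p v t)) (at (q v t)) (sens q v t))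
    (at v)"
proof -
  \<comment> \<open>The enriched gradient is independent of the momentum, so freezing the momentum
    at \<open>p v t\<close> does not change it along the family.\<close>
  have "(\<lambda>x. grad_q (H_enr M Hgeom Hnew \<theta> v) x (p v t)) differentiable (at (q v t))"
    unfolding enr_gradient
    using grads by (intro derivative_intros) auto
  from has_vector_derivative_compose_frechet[OF this sens_works[of q, OF q]] show ?thesis
    by (simp add: enr_gradient)
qed

text \<open>Induction along the steps in the order of the semi-implicit update: the new momentum
  comes first, and the new configuration is computed from it. The initial state is constant in the
  coefficient.\<close>

lemma rollout_differentiable:
  assumes init: "\<And>\<eta>. q \<eta> 0 = q0" "\<And>\<eta>. p \<eta> 0 = p0"
    and grads: "\<And>t. t < T \<Longrightarrow> grad (Hgeom \<theta>) differentiable (at (q v t))"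
      "\<And>t. t < T \<Longrightarrow> grad Hnew differentiable (at (q v t))"
    and "t \<le> T"
  shows "(\<lambda>\<eta>. q \<eta> t) differentiable (at v) \<and> (\<lambda>\<eta>. p \<eta> t) differentiable (at v)"
  using \<open>t \<le> T\<close>
proof (induction t)
  case 0
  then show ?case by (simp add: init)
next
  case (Suc t)
  then have t: "t < T" and q: "(\<lambda>\<eta>. q \<eta> t) differentiable (at v)"
    and p: "(\<lambda>\<eta>. p \<eta> t) differentiable (at v)" by auto
  have p': "(\<lambda>\<eta>. p \<eta> (Suc t)) differentiable (at v)"
    using momentum_sensitivity[OF t q p enriched_gradient_along_rollout[OF grads[OF t] q]]
    by (rule differentiableI_vector)
  then have "(\<lambda>\<eta>. matrix_inv M *v p \<eta> (Suc t)) differentiable (at v)"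
    by (intro differentiableI_vector[OF has_vector_derivative_mult_vec, OF sens_works[of p]])
  then have "(\<lambda>\<eta>. q \<eta> (Suc t)) differentiable (at v)"
    unfolding rollout_q[OF t] using q by (intro derivative_intros) auto
  with p' show ?case by blast
qed

lemma loss_sensitivity:
  fixes idx :: "'n::finite \<Rightarrow> nat"
  assumes init: "\<And>\<eta>. q \<eta> 0 = q0" "\<And>\<eta>. p \<eta> 0 = p0"
    and \<tau>: "\<tau> \<noteq> 0"
    and idx: "range idx \<subseteq> {..T}"
    and J: "J differentiable (at (rollout_data idx (q v) (p v)))"
    and q: "\<And>t. t \<le> T \<Longrightarrow> (\<lambda>\<eta>. q \<eta> t) differentiable (at v)"
    and p: "\<And>t. t \<le> T \<Longrightarrow> (\<lambda>\<eta>. p \<eta> t) differentiable (at v)"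
  shows "((\<lambda>\<eta>. J (rollout_data idx (q \<eta>) (p \<eta>))) has_real_derivative
    (- \<tau> * (\<Sum>t<T. dJ_dp idx J (q v) (p v) (Suc t) \<bullet> grad Hnew (q v t))
      + recursive_terms \<tau> M (H_enr M Hgeom Hnew \<theta> v) D idx J T q p v)) (at v)"
proof -
  let ?Q = "dJ_dq idx J (q v) (p v)" and ?P = "dJ_dp idx J (q v) (p v)"
  \<comment> \<open>The fixed initial state removes the time 0 terms, so the sum shifts to the times
    \<open>Suc t\<close>.\<close>
  have "sens q v 0 = 0" "sens p v 0 = 0" by (auto simp: sens_def init)
  then have "(\<Sum>t\<le>T. ?Q t \<bullet> sens q v t + ?P t \<bullet> sens p v t)
      = (\<Sum>t<T. ?Q (Suc t) \<bullet> sens q v (Suc t) + ?P (Suc t) \<bullet> sens p v (Suc t))"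
    by (simp add: sum.atMost_shift)
  \<comment> \<open>Only the momentum sensitivity is expanded by the update; the configuration
    sensitivity stays whole as part of the recursive terms.\<close>
  also have "\<dots> = (\<Sum>t<T. - \<tau> * (?P (Suc t) \<bullet> grad Hnew (q v t))
      + (?P (Suc t) \<bullet> (sens p v t - \<tau> *\<^sub>R sens_grad (H_enr M Hgeom Hnew \<theta> v) q p v t
            - \<tau> *\<^sub>R (D t *v (matrix_inv M *v sens p v t)))
         + ?Q (Suc t) \<bullet> sens q v (Suc t)))"
    using q p by (intro sum.cong) (auto simp: sens_p_Suc[OF \<tau>] inner_diff_right)
  also have "\<dots> = - \<tau> * (\<Sum>t<T. ?P (Suc t) \<bullet> grad Hnew (q v t))
      + recursive_terms \<tau> M (H_enr M Hgeom Hnew \<theta> v) D idx J T q p v"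
    by (simp only: sum.distrib sum_distrib_left recursive_terms_def)
  finally show ?thesis
    using loss_chain_rule[of J idx q v p T, OF J idx sens_works[of q, OF q] sens_works[of p, OF p]] by simp
qed

end

section \<open>Force channel, loss sensitivity and identifiability together\<close>

theorem lemma1:
  fixes M :: "real^'d^'d"
    and Hgeom :: "'th \<Rightarrow> real^'d \<Rightarrow> real"
    and Hnew :: "real^'d \<Rightarrow> real"
    and \<theta> :: 'th
    and vartheta \<tau> :: real
    and D :: "nat \<Rightarrow> real^'d^'d"
    and B :: "nat \<Rightarrow> real^'m^'d"
    and u :: "nat \<Rightarrow> real^'m"
    and T :: nat
    and q0 p0 :: "real^'d"
    and q p :: "real \<Rightarrow> nat \<Rightarrow> real^'d"
    and idx :: "'n::finite \<Rightarrow> nat"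
    and J :: "((real^'d)^'n) \<times> ((real^'d)^'n) \<Rightarrow> real"
    and S :: "(real^'d) set"
  assumes "pos_def M"
    and "\<And>x. Hgeom \<theta> differentiable (at x)"
    and "C1 Hnew"
    and "\<tau> > 0"
    and "\<And>t. pos_semidef (D t)"
    and "\<And>\<eta>. discrete_rollout \<tau> M (H_scaf M Hgeom \<theta>) Hnew D B u T \<eta> (q \<eta>) (p \<eta>)"
    and "\<And>\<eta>. q \<eta> 0 = q0" and "\<And>\<eta>. p \<eta> 0 = p0"
    and "bij_betw idx UNIV {..T}"
    and "\<And>z. J differentiable (at z)"
    and "subspace S"
  shows
    "\<comment> \<open>the new force channel in the momentum equation\<close>
     (\<forall>x y. - grad_q (H_enr M Hgeom Hnew \<theta> vartheta) x y
              = - grad_q (H_scaf M Hgeom \<theta>) x y + F_new Hnew vartheta x) \<and>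
     (\<forall>R I x y. momentum_equation (H_enr M Hgeom Hnew \<theta> vartheta) R I x y \<longleftrightarrow>
        (\<forall>s\<in>I. (y has_vector_derivative
                  (- grad_q (H_scaf M Hgeom \<theta>) (x s) (y s) + F_new Hnew vartheta (x s)
                    + R s (x s) (y s))) (at s within I))) \<and>
     \<comment> \<open>the direct sensitivity stream, given that the trajectory derivatives exist\<close>
     ((\<forall>t\<le>T. (\<lambda>\<eta>. q \<eta> t) differentiable (at vartheta) \<and>
              (\<lambda>\<eta>. p \<eta> t) differentiable (at vartheta)) \<longrightarrow>
       ((\<lambda>\<eta>. J (rollout_data idx (q \<eta>) (p \<eta>))) has_real_derivative
          (- \<tau> * (\<Sum>t<T. dJ_dp idx J (q vartheta) (p vartheta) (Suc t) \<bullet> grad Hnew (q vartheta t))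
           + recursive_terms \<tau> M (H_enr M Hgeom Hnew \<theta> vartheta) D idx J T q p vartheta)) (at vartheta)) \<and>
     \<comment> \<open>they do exist, and the recursive terms are linear in them, if the gradients are differentiable\<close>
     ((\<forall>t<T. grad (Hgeom \<theta>) differentiable (at (q vartheta t)) \<and>
              grad Hnew differentiable (at (q vartheta t))) \<longrightarrow>
       (\<forall>t\<le>T. (\<lambda>\<eta>. q \<eta> t) differentiable (at vartheta) \<and>
              (\<lambda>\<eta>. p \<eta> t) differentiable (at vartheta)) \<and>
       (\<forall>t<T. sens_grad (H_enr M Hgeom Hnew \<theta> vartheta) q p vartheta t =
               frechet_derivative (\<lambda>x. grad_q (H_enr M Hgeom Hnew \<theta> vartheta) x (p vartheta t))
                 (at (q vartheta t)) (sens q vartheta t))) \<and>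
     \<comment> \<open>identifiability from force observations requires non-degenerate excitation\<close>
     (let F = (\<lambda>\<eta> t. - grad_q (H_enr M Hgeom Hnew \<theta> \<eta>) (q vartheta t) (p vartheta t)
                      - D t *v (matrix_inv M *v p vartheta t) + B t *v u t);
          g = (\<lambda>t. grad Hnew (q vartheta t))
      in (force_identifiable S T F \<longrightarrow> invertible (observed_gram S T (\<lambda>_::1. g))) \<and>
         ((\<forall>v\<in>S. v \<noteq> 0 \<longrightarrow> force_identifiable (span {v}) T F) \<longrightarrow>
            nonsingular_on S (force_gram T g)))"
proof -
  have Hnew: "Hnew differentiable (at x)" for x
    using assms(3) by (simp add: C1_def)
  note scaf = grad_q_H_scaf[where Hgeom = Hgeom and \<theta> = \<theta> and M = M, OF assms(2)]
  note enr = grad_q_H_enr[where Hgeom = Hgeom and \<theta> = \<theta> and M = M and Hnew = Hnew,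
      OF assms(2) Hnew]
  have channel: "- grad_q (H_enr M Hgeom Hnew \<theta> vartheta) x y
      = - grad_q (H_scaf M Hgeom \<theta>) x y + F_new Hnew vartheta x" for x y
    by (simp add: scaf enr F_new_def)
  have idx: "range idx \<subseteq> {..T}"
    using assms(9) by (simp add: bij_betw_def)
  \<comment> \<open>The rollout stays at \<open>vartheta\<close>; only the coefficient inside the
    force varies.\<close>
  define F where "F = (\<lambda>\<eta> t. - grad_q (H_enr M Hgeom Hnew \<theta> \<eta>) (q vartheta t) (p vartheta t)
    - D t *v (matrix_inv M *v p vartheta t) + B t *v u t)"
  define g where "g = (\<lambda>t. grad Hnew (q vartheta t))"
  \<comment> \<open>The part of the force that is free of \<eta>, which makes the force affine in
    \<eta> with slope \<open>- g t\<close>.\<close>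
  define c where "c = (\<lambda>t. - grad (Hgeom \<theta>) (q vartheta t)
    - D t *v (matrix_inv M *v p vartheta t) + B t *v u t)"
  have F: "F \<eta> t = c t - \<eta> *\<^sub>R g t" for \<eta> t
    by (simp add: F_def c_def g_def enr)
  show ?thesis
    unfolding Let_def F_def[symmetric] g_def[symmetric]
  proof (intro conjI allI impI)
    fix x y
    show "- grad_q (H_enr M Hgeom Hnew \<theta> vartheta) x y
      = - grad_q (H_scaf M Hgeom \<theta>) x y + F_new Hnew vartheta x"
      by (rule channel)
  next
    fix R I x y
    show "momentum_equation (H_enr M Hgeom Hnew \<theta> vartheta) R I x y \<longleftrightarrow>
        (\<forall>s\<in>I. (y has_vector_derivative
                  (- grad_q (H_scaf M Hgeom \<theta>) (x s) (y s) + F_new Hnew vartheta (x s)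
                    + R s (x s) (y s))) (at s within I))"
      unfolding momentum_equation_def channel ..
  next
    assume "\<forall>t\<le>T. (\<lambda>\<eta>. q \<eta> t) differentiable (at vartheta) \<and>
              (\<lambda>\<eta>. p \<eta> t) differentiable (at vartheta)"
    then show "((\<lambda>\<eta>. J (rollout_data idx (q \<eta>) (p \<eta>))) has_real_derivative
          (- \<tau> * (\<Sum>t<T. dJ_dp idx J (q vartheta) (p vartheta) (Suc t) \<bullet> grad Hnew (q vartheta t))
           + recursive_terms \<tau> M (H_enr M Hgeom Hnew \<theta> vartheta) D idx J T q p vartheta)) (at vartheta)"
      using assms(4) by (intro loss_sensitivity[OF assms(2,3,6-8) _ idx assms(10)]) auto
  next
    fix t
    assume "\<forall>t<T. grad (Hgeom \<theta>) differentiable (at (q vartheta t)) \<and>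
              grad Hnew differentiable (at (q vartheta t))"
    then have diff: "(\<lambda>\<eta>. q \<eta> t) differentiable (at vartheta) \<and>
        (\<lambda>\<eta>. p \<eta> t) differentiable (at vartheta)" if "t \<le> T"
      using that by (intro rollout_differentiable[OF assms(2,3,6-8)]) auto
    then show "t \<le> T \<Longrightarrow> (\<lambda>\<eta>. q \<eta> t) differentiable (at vartheta)"
      "t \<le> T \<Longrightarrow> (\<lambda>\<eta>. p \<eta> t) differentiable (at vartheta)" by auto
    show "sens_grad (H_enr M Hgeom Hnew \<theta> vartheta) q p vartheta t =
        frechet_derivative (\<lambda>x. grad_q (H_enr M Hgeom Hnew \<theta> vartheta) x (p vartheta t))
          (at (q vartheta t)) (sens q vartheta t)" if "t < T"
      unfolding sens_grad_def using that diff
        \<open>\<forall>t<T. grad (Hgeom \<theta>) differentiable (at (q vartheta t)) \<and>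
              grad Hnew differentiable (at (q vartheta t))\<close>
      by (intro vector_derivative_at enriched_gradient_along_rollout[OF assms(2,3,6)]) auto
  next
    assume "force_identifiable S T F"
    then obtain t where "t < T" "closest_point S (g t) \<noteq> 0"
      using force_identifiable_excited[where c = c and g = g, OF assms(11) F] by blast
    then show "invertible (observed_gram S T (\<lambda>_::1. g))"
      by (rule invertible_observed_gram_single)
  next
    assume ident: "\<forall>v\<in>S. v \<noteq> 0 \<longrightarrow> force_identifiable (span {v}) T F"
    show "nonsingular_on S (force_gram T g)"
    proof (rule nonsingular_on_force_gram[OF assms(11)])
      \<comment> \<open>Each nonzero direction is treated as an observed subspace of its own, the
        line \<open>span {v}\<close>.\<close>
      fix v assume "v \<in> S" "v \<noteq> 0"
      then have "force_identifiable (span {v}) T F" using ident by blast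
      then show "\<exists>t<T. closest_point (span {v}) (g t) \<noteq> 0"
        using force_identifiable_excited[where c = c and g = g, OF subspace_span F] by blast
    qed
  qed
qed

end
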